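(* Let $\mathcal{H}$ be a real Hilbert space, $J\in\mathcal{C}$, and let $u$ solve the gradient flow of $J$ with initial datum $f$ satisfying $\bar f=0$ and with extinction time $T^*(f)<\infty$. Let $$w(t):=\begin{cases}\dfrac{u(t)}{T^*(f)-t},&0<t<T^*(f),\\ 0,&\text{else.}\end{cases}$$ Assume that there is an increasing sequence $(t_n)\subset(0,T^*(f))$ with $t_n\to T^*(f)$ such that $w(t_n)\to p^*$ strongly in $\mathcal{H}$ as $n\to\infty$ for some $p^*\in\mathcal{H}$. Then $p^*\in\partial J(p^* )$. If, moreover, there is $C>0$ such that $\|u(t)-\bar f\|\le C\,J(u(t))$ for all $t>0$, then $p^*\ne0$.
   Context: The class $\mathcal{C}$ consists of all maps $J:\mathcal{H}\to\mathbb{R}\cup\{+\infty\}$ that are convex, lower semicontinuous with respect to the strong topology of $\mathcal{H}$, and absolutely one-homogeneous, i.e. $J(cu)=|c|J(u)$ for all $u\in\mathcal{H}$, $c\in\mathbb{R}\setminus\{0\}$, and $J(0)=0$. The subdifferential is $\partial J(u)=\{p\in\mathcal{H}:\langle p,v\rangle\le J(v)\ \forall v\in\mathcal{H},\ \langle p,u\rangle=J(u)\}$, and $\mathrm{dom}(\partial J)=\{u:\partial J(u)\ne\emptyset\}$. $\bar f$ is the orthogonal projection of $f$ onto the closed linear space $\mathcal{N}(J)=\{u:J(u)=0\}$. The extinction time is $T^*(f):=\inf\{t>0:u(t)=\bar f\}$ (with $\inf\emptyset=+\infty$). Gradient flow: for $f\in\overline{\mathrm{dom}(\partial J)}$, the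 solution $(u,p)$ of $\partial_tu(t)=-p(t)$, $p(t)\in\partial J(u(t))$, $u(0)=f$ is the unique continuous $u:[0,\infty)\to\mathcal{H}$ with $u(0)=f$ given by Brezis' theory (Lipschitz on $[\delta,\infty)$ for every $\delta>0$, $u(t)\in\mathrm{dom}(\partial J)$ for all $t>0$, right-differentiable at every $t>0$), together with $p(t):=-\partial_t^+u(t)$, which is the element of minimal norm in $\partial J(u(t))$ for every $t>0$. *)

theory Defs
  imports "HOL-Analysis.Analysis"
begin

definition ereal_convex :: "('a::real_vector \<Rightarrow> ereal) \<Rightarrow> bool" where
  "ereal_convex J \<longleftrightarrow>
     (\<forall>u v. \<forall>s\<in>{0..1}. J ((1 - s) *\<^sub>R u + s *\<^sub>R v) \<le> ereal (1 - s) * J u + ereal s * J v)"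

definition lower_semicontinuous :: "('a::topological_space \<Rightarrow> ereal) \<Rightarrow> bool" where
  "lower_semicontinuous J \<longleftrightarrow> (\<forall>u. J u \<le> Liminf (at u) J)"

definition absolutely_one_homogeneous :: "('a::real_vector \<Rightarrow> ereal) \<Rightarrow> bool" where
  "absolutely_one_homogeneous J \<longleftrightarrow>
     (\<forall>u c. c \<noteq> 0 \<longrightarrow> J (c *\<^sub>R u) = ereal \<bar>c\<bar> * J u) \<and> J 0 = 0"

definition class_C :: "('a::real_inner \<Rightarrow> ereal) set" where
  "class_C = {J. (\<forall>u. J u \<noteq> -\<infinity>) \<and> ereal_convex J \<and> lower_semicontinuous J \<and>
                 absolutely_one_homogeneous J}"

text \<open>This is the form the convex subdifferential takes for functionals in \<open>class_C\<close>.\<close>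

definition subdifferential :: "('a::real_inner \<Rightarrow> ereal) \<Rightarrow> 'a \<Rightarrow> 'a set" where
  "subdifferential J u = {p. (\<forall>v. ereal (p \<bullet> v) \<le> J v) \<and> ereal (p \<bullet> u) = J u}"

definition dom_subdifferential :: "('a::real_inner \<Rightarrow> ereal) \<Rightarrow> 'a set" where
  "dom_subdifferential J = {u. subdifferential J u \<noteq> {}}"

definition null_space :: "('a \<Rightarrow> ereal) \<Rightarrow> 'a set" where
  "null_space J = {u. J u = 0}"

text \<open>The library's \<open>closest_point\<close> is restricted to Heine--Borel spaces, hence unavailable
  in infinite dimension.\<close>

definition orthogonal_projection :: "'a::real_inner set \<Rightarrow> 'a \<Rightarrow> 'a" where
  "orthogonal_projection N f = (THE g. g \<in> N \<and> (\<forall>v\<in>N. orthogonal (f - g) v))"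

definition null_projection :: "('a::real_inner \<Rightarrow> ereal) \<Rightarrow> 'a \<Rightarrow> 'a" where
  "null_projection J f = orthogonal_projection (null_space J) f"

text \<open>The solution in the sense of Brezis' theory. Only the values of \<open>u\<close> on \<open>[0, \<infinity>)\<close> and
  of \<open>p\<close> on \<open>(0, \<infinity>)\<close> matter; \<open>- p t\<close> is the right derivative of \<open>u\<close> at \<open>t\<close>.\<close>

definition gradient_flow ::
  "('a::real_inner \<Rightarrow> ereal) \<Rightarrow> 'a \<Rightarrow> (real \<Rightarrow> 'a) \<Rightarrow> (real \<Rightarrow> 'a) \<Rightarrow> bool" where
  "gradient_flow J f u p \<longleftrightarrow>
     f \<in> closure (dom_subdifferential J) \<and>
     continuous_on {0..} u \<and> u 0 = f \<and>
     (\<forall>\<delta>>0. \<exists>L. L-lipschitz_on {\<delta>..} u) \<and>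
     (\<forall>t>0. u t \<in> dom_subdifferential J \<and>
            (u has_vector_derivative - p t) (at_right t) \<and>
            is_arg_min norm (\<lambda>q. q \<in> subdifferential J (u t)) (p t))"

text \<open>The infimum over the empty set is \<open>\<infinity>\<close> in \<^typ>\<open>ereal\<close>.\<close>

definition extinction_time :: "('a::real_inner \<Rightarrow> ereal) \<Rightarrow> 'a \<Rightarrow> (real \<Rightarrow> 'a) \<Rightarrow> ereal" where
  "extinction_time J f u = Inf {ereal t |t. 0 < t \<and> u t = null_projection J f}"

definition rescaled_flow :: "(real \<Rightarrow> 'a::real_vector) \<Rightarrow> real \<Rightarrow> real \<Rightarrow> 'a" where
  "rescaled_flow u T t = (if 0 < t \<and> t < T then u t /\<^sub>R (T - t) else 0)"

end

theory Submission
  imports Defs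
begin

text \<open>
  In the logarithmic time \<open>s\<close> given by \<open>t = T - exp (-s)\<close>, the rescaled flow
  \<open>w(s) = exp s *\<^sub>R u (T - exp (-s))\<close> solves \<open>w' = w - q\<close> with \<open>q(s) = p(t)\<close>, and \<open>q \<in> \<partial>J(w)\<close>
  because the subdifferential of a one-homogeneous functional is invariant under positive scaling.
  This is the gradient flow of the nonconvex energy \<open>E(w) = J(w) - \<parallel>w\<parallel>\<^sup>2 / 2\<close>, so formally
  \<open>dE/ds = - \<parallel>w'\<parallel>\<^sup>2\<close>. As \<open>J \<ge> 0\<close> and \<open>w\<close> stays bounded along the given sequence \<open>s\<^sub>n \<rightarrow> \<infinity>\<close>, the
  energy is bounded below, hence it drops by an arbitrarily small amount after \<open>s\<^sub>n\<close>. On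
  \<open>[s\<^sub>n, s\<^sub>n + 1]\<close> the solution then hardly moves (\<open>displacement_le\<close>), and at some time \<open>r\<close> of that
  interval its velocity \<open>w - q\<close> is small (\<open>exists_small_velocity\<close>). At such times both \<open>w(r)\<close> and
  \<open>q(r) \<in> \<partial>J(w(r))\<close> are close to the limit of \<open>w(s\<^sub>n)\<close>, and the strong-strong closedness of the
  subdifferential (\<open>subdifferential_closed\<close>) shows that the limit is an eigenvector.

  The formal dissipation identity becomes a proof through one-sided estimates. A function that is
  lower semicontinuous from the left is nonincreasing as soon as its lower right Dini derivative is
  nonpositive (\<open>nonincreasing_if_frequently_right\<close>), and the dissipation inequality for that Dini
  derivative (\<open>frequently_energy_decrease\<close>) comes from comparing \<open>\<parallel>w(r) - w(t)\<parallel>\<^sup>2\<close> with its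
  second-order expansion at \<open>t\<close>.

  If \<open>\<parallel>u\<parallel> \<le> C J(u)\<close>, then \<open>\<parallel>u\<parallel>' = - J(u) / \<parallel>u\<parallel> \<le> - 1/C\<close> as long as \<open>u \<noteq> 0\<close>. So \<open>\<parallel>u(t)\<parallel>\<close> must be
  at least \<open>(T - t) / C\<close> in order not to become negative before \<open>T\<close>
  (\<open>norm_ge_remaining_time\<close>), and \<open>w\<close> stays away from zero.
\<close>

section \<open>Monotonicity from one-sided derivatives\<close>

text \<open>
  A Dini derivative criterion. For fixed \<open>\<epsilon>\<close>, semicontinuity puts the supremum of the times at which
  \<open>\<phi> t \<le> \<phi> a + \<epsilon> (t - a)\<close> into the set of these times, and the condition on the right pushes the
  supremum up to \<open>b\<close>. Only arbitrarily close times to the right of \<open>t\<close> are asked for, because the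
  energy estimate below says nothing about the other ones.
\<close>

lemma nonincreasing_if_frequently_right:
  fixes \<phi> :: "real \<Rightarrow> real"
  assumes "a \<le> b"
    and left: "\<And>t e. a < t \<Longrightarrow> t \<le> b \<Longrightarrow> 0 < e \<Longrightarrow> \<forall>\<^sub>F r in at_left t. \<phi> t - e < \<phi> r"
    and right: "\<And>t e. a \<le> t \<Longrightarrow> t < b \<Longrightarrow> 0 < e \<Longrightarrow>
                  \<exists>\<^sub>F s in at_right t. \<phi> s \<le> \<phi> t + e * (s - t)"
  shows "\<phi> b \<le> \<phi> a"
proof -
  have *: "\<phi> b \<le> \<phi> a + \<epsilon> * (b - a)" if "0 < \<epsilon>" for \<epsilon>
  proof -
    define S where "S = {t\<in>{a..b}. \<phi> t \<le> \<phi> a + \<epsilon> * (t - a)}"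
    define c where "c = Sup S"
    have aS: "a \<in> S" using \<open>a \<le> b\<close> by (simp add: S_def)
    have bdd: "bdd_above S" by (rule bdd_aboveI[of _ b]) (simp add: S_def)
    have ac: "a \<le> c" unfolding c_def using aS bdd by (rule cSup_upper)
    have cb: "c \<le> b" unfolding c_def using aS by (intro cSup_least) (auto simp: S_def)
    have cS: "c \<in> S"
    proof (rule ccontr)
      assume "c \<notin> S"
      then have "a < c" using aS ac by (cases "a = c") auto
      define e where "e = \<phi> c - \<phi> a - \<epsilon> * (c - a)"
      have "0 < e" using \<open>c \<notin> S\<close> ac cb by (simp add: S_def e_def)
      from left[OF \<open>a < c\<close> cb this] obtain d where "d < c"
        and d: "\<And>r. d < r \<Longrightarrow> r < c \<Longrightarrow> \<phi> c - e < \<phi> r"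
        by (auto simp: eventually_at_left_field)
      obtain r where r: "r \<in> S" "d < r"
        using less_cSupD[of S d] aS \<open>d < c\<close> by (auto simp: c_def)
      have "r \<le> c" unfolding c_def using r(1) bdd by (rule cSup_upper)
      with r \<open>c \<notin> S\<close> have "r < c" by (cases "r = c") auto
      have "\<epsilon> * (r - a) \<le> \<epsilon> * (c - a)" using \<open>r < c\<close> \<open>0 < \<epsilon>\<close> by simp
      with d[OF r(2) \<open>r < c\<close>] r(1) show False by (simp add: S_def e_def)
    qed
    have "c = b"
    proof (rule ccontr)
      assume "c \<noteq> b"
      then have "c < b" using cb by simp
      have "\<exists>\<^sub>F s in at_right c. \<phi> s \<le> \<phi> c + \<epsilon> * (s - c) \<and> s \<in> {c<..<b}"
        by (rule frequently_eventually_frequently[OF right[OF ac \<open>c < b\<close> \<open>0 < \<epsilon>\<close>]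
              eventually_at_right_real[OF \<open>c < b\<close>]])
      then obtain s where s: "\<phi> s \<le> \<phi> c + \<epsilon> * (s - c)" "c < s" "s < b"
        by (auto dest: frequently_ex)
      have "\<phi> c + \<epsilon> * (s - c) \<le> \<phi> a + \<epsilon> * (s - a)"
        using cS by (simp add: S_def algebra_simps)
      then have "s \<in> S" using s ac by (simp add: S_def)
      then have "s \<le> c" unfolding c_def using bdd by (rule cSup_upper)
      with s show False by simp
    qed
    with cS show ?thesis by (simp add: S_def)
  qed
  show ?thesis
  proof (cases "a = b")
    case False
    then have "0 < b - a" using \<open>a \<le> b\<close> by simp
    show ?thesis
    proof (rule field_le_epsilon)
      fix e :: real assume "0 < e"
      with *[of "e / (b - a)"] \<open>0 < b - a\<close> show "\<phi> b \<le> \<phi> a + e" by simp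
    qed
  qed simp
qed

lemma eventually_right_derivative_less:
  fixes \<phi> :: "real \<Rightarrow> real"
  assumes "(\<phi> has_vector_derivative D) (at_right t)" and "D < c"
  shows "\<forall>\<^sub>F s in at_right t. \<phi> s < \<phi> t + c * (s - t)"
proof -
  have "((\<lambda>s. (\<phi> s - \<phi> t) / (s - t)) \<longlongrightarrow> D) (at_right t)"
    using assms(1)
    by (simp add: has_real_derivative_iff_has_vector_derivative[symmetric] has_field_derivative_iff)
  from order_tendstoD(2)[OF this assms(2)]
  have "\<forall>\<^sub>F s in at_right t. (\<phi> s - \<phi> t) / (s - t) < c" .
  then show ?thesis
    using eventually_at_right_less[of t]
    by eventually_elim (simp add: field_simps)
qed

lemma nonincreasing_if_right_derivative_le_0:
  fixes \<phi> :: "real \<Rightarrow> real"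
  assumes "a \<le> b" and cont: "continuous_on {a..b} \<phi>"
    and deriv: "\<And>t. a \<le> t \<Longrightarrow> t < b \<Longrightarrow> (\<phi> has_vector_derivative \<phi>' t) (at_right t)"
    and le: "\<And>t. a \<le> t \<Longrightarrow> t < b \<Longrightarrow> \<phi>' t \<le> 0"
  shows "\<phi> b \<le> \<phi> a"
proof (rule nonincreasing_if_frequently_right[OF \<open>a \<le> b\<close>])
  fix t e :: real assume t: "a < t" "t \<le> b" and "0 < e"
  have "continuous_on {a..t} \<phi>"
    using cont by (rule continuous_on_subset) (use t in auto)
  then have "(\<phi> \<longlongrightarrow> \<phi> t) (at_left t)"
    using t(1) by (rule continuous_on_Icc_at_leftD)
  then show "\<forall>\<^sub>F r in at_left t. \<phi> t - e < \<phi> r"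
    by (rule order_tendstoD) (use \<open>0 < e\<close> in simp)
next
  fix t e :: real assume t: "a \<le> t" "t < b" and "0 < e"
  have "\<forall>\<^sub>F s in at_right t. \<phi> s < \<phi> t + e * (s - t)"
    using deriv[OF t] by (rule eventually_right_derivative_less) (use le[OF t] \<open>0 < e\<close> in simp)
  then show "\<exists>\<^sub>F s in at_right t. \<phi> s \<le> \<phi> t + e * (s - t)"
    by (intro eventually_frequently) (auto elim: eventually_mono)
qed

section \<open>Energy dissipation in logarithmic time\<close>

text \<open>
  The parameter \<open>s\<close> stands for the logarithmic time, which runs to infinity as the original time
  approaches extinction. Derivatives are from the right, as they are for the gradient flow.
\<close>

locale rescaled_solution =
  fixes J :: "'a::real_inner \<Rightarrow> ereal" and w q :: "real \<Rightarrow> 'a" and s0 :: real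
  assumes cont: "continuous_on {s0<..} w"
    and deriv: "\<And>s. s0 < s \<Longrightarrow> (w has_vector_derivative w s - q s) (at_right s)"
    and subgrad: "\<And>s. s0 < s \<Longrightarrow> q s \<in> subdifferential J (w s)"
begin

text \<open>
  The value \<open>J(w) - \<parallel>w\<parallel>\<^sup>2 / 2\<close>, made real by writing the finite number \<open>J(w)\<close> as \<open>q \<bullet> w\<close>.
\<close>

definition energy :: "real \<Rightarrow> real" where
  "energy s = q s \<bullet> w s - (norm (w s))\<^sup>2 / 2"

lemma isCont_w: "s0 < s \<Longrightarrow> isCont w s"
  using cont by (simp add: continuous_on_eq_continuous_at open_greaterThan)

lemma subgradient_le:
  assumes "s0 < s" "s0 < t"
  shows "q s \<bullet> w t \<le> q t \<bullet> w t"
proof -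
  have "ereal (q s \<bullet> w t) \<le> J (w t)" "ereal (q t \<bullet> w t) = J (w t)"
    using subgrad[OF assms(1)] subgrad[OF assms(2)] by (auto simp: subdifferential_def)
  then show ?thesis by (metis ereal_less_eq(3))
qed

text \<open>
  Let \<open>D = \<parallel>w'(t)\<parallel>\<^sup>2\<close> and \<open>g(r) = \<parallel>w(r) - w(t)\<parallel>\<^sup>2 / 2\<close>, so that
  \<open>g(r) = D (r - t)\<^sup>2 / 2 + o((r - t)\<^sup>2)\<close> as \<open>r\<close> decreases to \<open>t\<close>.
  The subgradient inequality gives \<open>g'(r) \<le> energy t - energy r + g(r)\<close>. If the energy decreased
  more slowly than claimed at all times just after \<open>t\<close>, this would give
  \<open>g'(r) \<le> (D - \<epsilon>/2) (r - t)\<close>, the term \<open>g(r)\<close> being of second order, and \<open>g\<close> would be too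
  small to match its expansion.
\<close>

lemma frequently_energy_decrease:
  assumes "s0 < t" "0 < \<epsilon>"
  shows "\<exists>\<^sub>F r in at_right t. energy r \<le> energy t - ((norm (w t - q t))\<^sup>2 - \<epsilon>) * (r - t)"
proof (rule ccontr)
  define D where "D = (norm (w t - q t))\<^sup>2"
  define g where "g r = (norm (w r - w t))\<^sup>2 / 2" for r
  assume "\<not> (\<exists>\<^sub>F r in at_right t. energy r \<le> energy t - ((norm (w t - q t))\<^sup>2 - \<epsilon>) * (r - t))"
  then have slow: "\<forall>\<^sub>F r in at_right t. energy t - energy r < (D - \<epsilon>) * (r - t)"
    by (auto simp: not_frequently not_le D_def algebra_simps elim: eventually_mono)
  have quot: "((\<lambda>r. (w r - w t) /\<^sub>R (r - t)) \<longlongrightarrow> w t - q t) (at_right t)"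
  proof -
    have "((\<lambda>r. (w r - w t - (r - t) *\<^sub>R (w t - q t)) /\<^sub>R norm (r - t)) \<longlongrightarrow> 0) (at_right t)"
      using deriv[OF \<open>s0 < t\<close>]
      by (simp add: has_vector_derivative_def has_derivative_within inverse_eq_divide diff_diff_add)
    then have "((\<lambda>r. (w r - w t - (r - t) *\<^sub>R (w t - q t)) /\<^sub>R norm (r - t) + (w t - q t))
        \<longlongrightarrow> 0 + (w t - q t)) (at_right t)"
      by (intro tendsto_add tendsto_const)
    moreover have "\<forall>\<^sub>F r in at_right t.
        (w r - w t - (r - t) *\<^sub>R (w t - q t)) /\<^sub>R norm (r - t) + (w t - q t) = (w r - w t) /\<^sub>R (r - t)"
      using eventually_at_right_less[of t]
      by eventually_elim (simp add: scaleR_diff_right)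
    ultimately show ?thesis by (simp add: tendsto_cong)
  qed
  have glim: "((\<lambda>r. g r / (r - t)\<^sup>2) \<longlongrightarrow> D / 2) (at_right t)"
  proof -
    have "((\<lambda>r. (norm ((w r - w t) /\<^sub>R (r - t)))\<^sup>2 / 2) \<longlongrightarrow> D / 2) (at_right t)"
      unfolding D_def by (intro tendsto_intros quot) simp
    moreover have "(norm ((w r - w t) /\<^sub>R (r - t)))\<^sup>2 / 2 = g r / (r - t)\<^sup>2" for r
      by (simp add: g_def power_mult_distrib inverse_eq_divide power_divide)
    ultimately show ?thesis by simp
  qed
  have small: "\<forall>\<^sub>F r in at_right t. g r < \<epsilon> / 2 * (r - t)"
  proof -
    have "((\<lambda>r. g r / (r - t)\<^sup>2 * (r - t)) \<longlongrightarrow> D / 2 * (t - t)) (at_right t)"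
      by (intro tendsto_intros glim)
    then have "\<forall>\<^sub>F r in at_right t. g r / (r - t)\<^sup>2 * (r - t) < \<epsilon> / 2"
      by (rule order_tendstoD) (use \<open>0 < \<epsilon>\<close> in simp)
    then show ?thesis
      using eventually_at_right_less[of t]
    proof eventually_elim
      case (elim r)
      then have "g r / (r - t) < \<epsilon> / 2" by (simp add: power2_eq_square)
      then show ?case using elim(2) by (simp add: pos_divide_less_eq)
    qed
  qed
  from eventually_conj[OF slow small] obtain b where "t < b"
    and b: "\<And>r. t < r \<Longrightarrow> r < b \<Longrightarrow>
        energy t - energy r < (D - \<epsilon>) * (r - t) \<and> g r < \<epsilon> / 2 * (r - t)"
    by (auto simp: eventually_at_right_field)
  have gderiv: "(g has_vector_derivative (w r - q r) \<bullet> (w r - w t)) (at_right r)" if "t \<le> r" for r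
  proof -
    have "((\<lambda>r. w r - w t) has_vector_derivative w r - q r) (at_right r)"
      using deriv[of r] that \<open>s0 < t\<close> by (simp add: has_vector_derivative_diff_const)
    from bounded_bilinear.has_vector_derivative[OF bounded_bilinear_inner this this]
    have "((\<lambda>r. (w r - w t) \<bullet> (w r - w t)) has_real_derivative 2 * ((w r - q r) \<bullet> (w r - w t))) (at_right r)"
      by (simp add: has_real_derivative_iff_has_vector_derivative inner_commute)
    from DERIV_cdivide[OF this, of 2] show ?thesis
      by (simp add: g_def[abs_def] power2_norm_eq_inner has_real_derivative_iff_has_vector_derivative)
  qed
  have bound: "g s \<le> (D - \<epsilon> / 2) * (s - t)\<^sup>2 / 2" if "t < s" "s < b" for s
  proof -
    have "g s - (D - \<epsilon> / 2) * (s - t)\<^sup>2 / 2 \<le> g t - (D - \<epsilon> / 2) * (t - t)\<^sup>2 / 2"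
    proof (rule nonincreasing_if_right_derivative_le_0[of t s
          "\<lambda>r. g r - (D - \<epsilon> / 2) * (r - t)\<^sup>2 / 2"
          "\<lambda>r. (w r - q r) \<bullet> (w r - w t) - (D - \<epsilon> / 2) * (r - t)"])
      have "continuous_on {t..s} w"
        using cont by (rule continuous_on_subset) (use \<open>s0 < t\<close> in auto)
      then show "continuous_on {t..s} (\<lambda>r. g r - (D - \<epsilon> / 2) * (r - t)\<^sup>2 / 2)"
        unfolding g_def by (intro continuous_intros) auto
    next
      fix r assume "t \<le> r" "r < s"
      have "((\<lambda>r. (D - \<epsilon> / 2) * (r - t)\<^sup>2 / 2) has_vector_derivative (D - \<epsilon> / 2) * (r - t)) (at_right r)"
        unfolding has_real_derivative_iff_has_vector_derivative[symmetric]
        by (auto intro!: derivative_eq_intros)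
      with gderiv[OF \<open>t \<le> r\<close>]
      show "((\<lambda>r. g r - (D - \<epsilon> / 2) * (r - t)\<^sup>2 / 2) has_vector_derivative
          (w r - q r) \<bullet> (w r - w t) - (D - \<epsilon> / 2) * (r - t)) (at_right r)"
        by (rule has_vector_derivative_diff)
    next
      fix r assume r: "t \<le> r" "r < s"
      show "(w r - q r) \<bullet> (w r - w t) - (D - \<epsilon> / 2) * (r - t) \<le> 0"
      proof (cases "r = t")
        case False
        then have "t < r" "r < b" using r that by auto
        have "(w r - q r) \<bullet> (w r - w t) = energy t - energy r + g r + (q r \<bullet> w t - q t \<bullet> w t)"
          by (simp add: energy_def g_def power2_norm_eq_inner algebra_simps inner_commute
              field_simps)
        also have "\<dots> \<le> energy t - energy r + g r"
          using subgradient_le[of r t] \<open>s0 < t\<close> \<open>t < r\<close> by simp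
        also have "\<dots> \<le> (D - \<epsilon> / 2) * (r - t)"
          using b[OF \<open>t < r\<close> \<open>r < b\<close>] by (auto simp: algebra_simps diff_divide_distrib)
        finally show ?thesis by simp
      qed simp
    qed (use that in auto)
    then show ?thesis by (simp add: g_def)
  qed
  have "\<forall>\<^sub>F s in at_right t. g s / (s - t)\<^sup>2 \<le> (D - \<epsilon> / 2) / 2"
    using eventually_at_right_real[OF \<open>t < b\<close>]
    by eventually_elim (use bound in \<open>simp add: field_simps\<close>)
  then have "D / 2 \<le> (D - \<epsilon> / 2) / 2"
    using glim by (intro tendsto_upperbound[of _ "D / 2" "at_right t"]) auto
  then show False using \<open>0 < \<epsilon>\<close> by simp
qed

text \<open>
  The dissipation identity in a form free of integrals: instead of integrating \<open>\<parallel>w'\<parallel>\<^sup>2\<close>, one adds a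
  function growing no faster than the energy dissipates. The energy is lower semicontinuous from the
  left because \<open>q t \<bullet> w r\<close>, which is continuous in \<open>r\<close>, bounds \<open>q r \<bullet> w r\<close> from below.
\<close>

lemma energy_plus_nonincreasing:
  assumes "s0 < a" "a \<le> b"
    and psi: "continuous_on {a..b} \<psi>"
    and dpsi: "\<And>t. a \<le> t \<Longrightarrow> t < b \<Longrightarrow> (\<psi> has_vector_derivative \<psi>' t) (at_right t)"
    and le: "\<And>t. a \<le> t \<Longrightarrow> t < b \<Longrightarrow> \<psi>' t \<le> (norm (w t - q t))\<^sup>2"
  shows "energy b + \<psi> b \<le> energy a + \<psi> a"
proof (rule nonincreasing_if_frequently_right[of a b "\<lambda>t. energy t + \<psi> t"])
  fix t e :: real assume t: "a < t" "t \<le> b" and "0 < e"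
  have "continuous_on {a..t} \<psi>"
    using psi by (rule continuous_on_subset) (use t in auto)
  then have psi_left: "(\<psi> \<longlongrightarrow> \<psi> t) (at_left t)"
    using t(1) by (rule continuous_on_Icc_at_leftD)
  have w_left: "(w \<longlongrightarrow> w t) (at_left t)"
    using isCont_w[of t] t \<open>s0 < a\<close> by (simp add: isCont_def filterlim_at_split)
  let ?m = "\<lambda>r. q t \<bullet> w r - (norm (w r))\<^sup>2 / 2 + \<psi> r"
  have "(?m \<longlongrightarrow> q t \<bullet> w t - (norm (w t))\<^sup>2 / 2 + \<psi> t) (at_left t)"
    by (intro tendsto_intros psi_left w_left) simp
  then have "\<forall>\<^sub>F r in at_left t. energy t + \<psi> t - e < ?m r"
    by (rule order_tendstoD) (use \<open>0 < e\<close> in \<open>simp add: energy_def\<close>)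
  then show "\<forall>\<^sub>F r in at_left t. energy t + \<psi> t - e < energy r + \<psi> r"
    using eventually_at_left_real[OF \<open>a < t\<close>]
  proof eventually_elim
    case (elim r)
    with subgradient_le[of t r] t \<open>s0 < a\<close> show ?case by (simp add: energy_def)
  qed
next
  fix t e :: real assume t: "a \<le> t" "t < b" and "0 < e"
  have "\<forall>\<^sub>F s in at_right t. \<psi> s < \<psi> t + ((norm (w t - q t))\<^sup>2 + e / 2) * (s - t)"
    using dpsi[OF t]
    by (rule eventually_right_derivative_less) (use le[OF t] \<open>0 < e\<close> in simp)
  moreover have "\<exists>\<^sub>F s in at_right t.
      energy s \<le> energy t - ((norm (w t - q t))\<^sup>2 - e / 2) * (s - t)"
    by (rule frequently_energy_decrease) (use t \<open>s0 < a\<close> \<open>0 < e\<close> in auto)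
  ultimately have "\<exists>\<^sub>F s in at_right t.
      energy s \<le> energy t - ((norm (w t - q t))\<^sup>2 - e / 2) * (s - t) \<and>
      \<psi> s < \<psi> t + ((norm (w t - q t))\<^sup>2 + e / 2) * (s - t)"
    by (intro frequently_eventually_frequently)
  then show "\<exists>\<^sub>F s in at_right t. energy s + \<psi> s \<le> energy t + \<psi> t + e * (s - t)"
    by (rule frequently_elim1) (auto simp: algebra_simps diff_divide_distrib)
qed (fact assms(2))

lemma energy_antimono:
  assumes "s0 < a" "a \<le> b"
  shows "energy b \<le> energy a"
  using energy_plus_nonincreasing[of a b "\<lambda>_. 0" "\<lambda>_. 0"] assms by simp

text \<open>
  Formally, \<open>2 \<eta> \<parallel>w'\<parallel> \<le> \<parallel>w'\<parallel>\<^sup>2 + \<eta>\<^sup>2\<close> integrated over \<open>[a, r]\<close>. Since the norm is not differentiable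
  at 0, the displacement is measured along the fixed direction
  \<open>sgn (w r - w a)\<close>.
\<close>

lemma displacement_le:
  assumes "s0 < a" "a \<le> r" "0 < \<eta>"
  shows "2 * \<eta> * norm (w r - w a) \<le> energy a - energy r + \<eta>\<^sup>2 * (r - a)"
proof -
  define e where "e = sgn (w r - w a)"
  have ne: "norm e \<le> 1" by (simp add: e_def norm_sgn)
  have "energy r + (2 * \<eta> * (e \<bullet> w r) - \<eta>\<^sup>2 * r) \<le> energy a + (2 * \<eta> * (e \<bullet> w a) - \<eta>\<^sup>2 * a)"
  proof (rule energy_plus_nonincreasing[of a r "\<lambda>t. 2 * \<eta> * (e \<bullet> w t) - \<eta>\<^sup>2 * t"
        "\<lambda>t. 2 * \<eta> * (e \<bullet> (w t - q t)) - \<eta>\<^sup>2"])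
    have "continuous_on {a..r} w"
      using cont by (rule continuous_on_subset) (use \<open>s0 < a\<close> in auto)
    then show "continuous_on {a..r} (\<lambda>t. 2 * \<eta> * (e \<bullet> w t) - \<eta>\<^sup>2 * t)"
      by (intro continuous_intros)
  next
    fix t assume "a \<le> t" "t < r"
    then have "s0 < t" using \<open>s0 < a\<close> by simp
    from bounded_linear.has_vector_derivative[OF bounded_linear_inner_right deriv[OF this], of e]
    have "((\<lambda>t. e \<bullet> w t) has_real_derivative e \<bullet> (w t - q t)) (at_right t)"
      by (simp add: has_real_derivative_iff_has_vector_derivative)
    then show "((\<lambda>t. 2 * \<eta> * (e \<bullet> w t) - \<eta>\<^sup>2 * t) has_vector_derivative
        2 * \<eta> * (e \<bullet> (w t - q t)) - \<eta>\<^sup>2) (at_right t)"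
      unfolding has_real_derivative_iff_has_vector_derivative[symmetric]
      by (auto intro!: derivative_eq_intros)
  next
    fix t
    have "e \<bullet> (w t - q t) \<le> norm e * norm (w t - q t)" by (rule norm_cauchy_schwarz)
    also have "\<dots> \<le> norm (w t - q t)" using ne by (simp add: mult_left_le_one_le)
    finally have "2 * \<eta> * (e \<bullet> (w t - q t)) - \<eta>\<^sup>2 \<le> 2 * \<eta> * norm (w t - q t) - \<eta>\<^sup>2"
      using \<open>0 < \<eta>\<close> by simp
    also have "\<dots> \<le> (norm (w t - q t))\<^sup>2"
      using zero_le_power2[of "norm (w t - q t) - \<eta>"] by (simp add: power2_diff algebra_simps)
    finally show "2 * \<eta> * (e \<bullet> (w t - q t)) - \<eta>\<^sup>2 \<le> (norm (w t - q t))\<^sup>2" .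
  qed (use assms in auto)
  moreover have "e \<bullet> (w r - w a) = norm (w r - w a)"
    unfolding e_def sgn_div_norm inner_scaleR_left dot_square_norm
    by (cases "w r = w a") (auto simp: power2_eq_square)
  then have "2 * \<eta> * norm (w r - w a) = 2 * \<eta> * (e \<bullet> w r) - 2 * \<eta> * (e \<bullet> w a)"
    by (metis inner_diff_right right_diff_distrib)
  ultimately show ?thesis by (simp add: algebra_simps)
qed

lemma exists_small_velocity:
  assumes "s0 < a" "energy a - energy (a + 1) < \<eta>\<^sup>2" "0 < \<eta>"
  obtains r where "a \<le> r" "r < a + 1" "norm (w r - q r) < \<eta>"
proof (rule ccontr)
  assume "\<not> thesis"
  with that have big: "\<eta> \<le> norm (w r - q r)" if "a \<le> r" "r < a + 1" for r
    using that by (meson not_less)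
  have "energy (a + 1) + \<eta>\<^sup>2 * (a + 1) \<le> energy a + \<eta>\<^sup>2 * a"
  proof (rule energy_plus_nonincreasing[of a "a + 1" "\<lambda>t. \<eta>\<^sup>2 * t" "\<lambda>_. \<eta>\<^sup>2"])
    fix t :: real
    show "((\<lambda>t. \<eta>\<^sup>2 * t) has_vector_derivative \<eta>\<^sup>2) (at_right t)"
      by (rule has_vector_derivative_eq_rhs) (auto intro!: derivative_eq_intros)
  next
    fix t assume "a \<le> t" "t < a + 1"
    then show "\<eta>\<^sup>2 \<le> (norm (w t - q t))\<^sup>2"
      using big \<open>0 < \<eta>\<close> by (simp add: power_mono)
  qed (use assms in \<open>auto intro!: continuous_intros\<close>)
  with assms show False by (simp add: algebra_simps)
qed

end

section \<open>Subdifferentials of one-homogeneous functionals\<close>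

lemma subdifferential_closed:
  assumes lsc: "lower_semicontinuous J"
    and sub: "\<And>n. q n \<in> subdifferential J (x n)"
    and x: "x \<longlonglongrightarrow> x'" and q: "q \<longlonglongrightarrow> q'"
  shows "q' \<in> subdifferential J x'"
proof -
  have le: "ereal (q' \<bullet> v) \<le> J v" for v
  proof (rule tendsto_upperbound)
    show "(\<lambda>n. ereal (q n \<bullet> v)) \<longlonglongrightarrow> ereal (q' \<bullet> v)"
      by (intro tendsto_intros q)
    show "\<forall>\<^sub>F n in sequentially. ereal (q n \<bullet> v) \<le> J v"
      using sub by (simp add: subdifferential_def)
  qed simp
  have "J x' \<le> ereal (q' \<bullet> x')"
  proof (rule ccontr)
    assume "\<not> J x' \<le> ereal (q' \<bullet> x')"
    then obtain c where c: "ereal (q' \<bullet> x') < c" "c < J x'"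
      using dense[of "ereal (q' \<bullet> x')" "J x'"] by (auto simp: not_le)
    have "J x' \<le> Liminf (at x') J" using lsc by (simp add: lower_semicontinuous_def)
    with c(2) have "\<forall>\<^sub>F y in at x'. c < J y"
      by (auto simp: le_Liminf_iff)
    with c(2) have "\<forall>\<^sub>F y in nhds x'. c < J y"
      by (auto simp: eventually_at_filter elim: eventually_mono)
    from eventually_compose_filterlim[OF this x]
    have above: "\<forall>\<^sub>F n in sequentially. c < J (x n)" .
    have "(\<lambda>n. ereal (q n \<bullet> x n)) \<longlonglongrightarrow> ereal (q' \<bullet> x')"
      by (intro tendsto_intros q x)
    from order_tendstoD(2)[OF this c(1)]
    have "\<forall>\<^sub>F n in sequentially. J (x n) < c"
      using sub by (auto simp: subdifferential_def)
    with above have "\<forall>\<^sub>F n::nat in sequentially. False"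
      by eventually_elim simp
    then show False by simp
  qed
  with le show ?thesis by (auto simp: subdifferential_def intro: antisym)
qed

text \<open>
  Testing the subgradient inequality with \<open>- x\<close> works since \<open>J\<close> is even.
\<close>

lemma subgradient_inner_nonneg:
  assumes "absolutely_one_homogeneous J" "q \<in> subdifferential J x"
  shows "0 \<le> q \<bullet> x"
proof -
  have "ereal (q \<bullet> (- x)) \<le> J (- x)" using assms(2) unfolding subdifferential_def by blast
  also have "J (- x) = J x"
    using assms(1)[unfolded absolutely_one_homogeneous_def, THEN conjunct1, rule_format, of "-1" x]
    by simp
  also have "J x = ereal (q \<bullet> x)" using assms(2) by (simp add: subdifferential_def)
  finally show ?thesis by simp
qed

lemma subdifferential_scaleR:
  assumes "absolutely_one_homogeneous J" "q \<in> subdifferential J x" "0 < c"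
  shows "q \<in> subdifferential J (c *\<^sub>R x)"
proof -
  have "J (c *\<^sub>R x) = ereal c * J x"
    using assms(1,3) by (simp add: absolutely_one_homogeneous_def)
  also have "J x = ereal (q \<bullet> x)" using assms(2) by (simp add: subdifferential_def)
  finally show ?thesis using assms(2) by (simp add: subdifferential_def)
qed

section \<open>Limit points of the rescaled flow\<close>

text \<open>
  The times \<open>\<sigma> n\<close> are replaced by nearby times at which the velocity \<open>w - q\<close> is small. For this it
  suffices that the energy is bounded below, which the convergence along \<open>\<sigma>\<close> guarantees.
\<close>

lemma (in rescaled_solution) limit_point_is_eigenvector:
  assumes lsc: "lower_semicontinuous J" and hom: "absolutely_one_homogeneous J"
    and sig: "filterlim \<sigma> at_top sequentially"
    and lim: "(\<lambda>n. w (\<sigma> n)) \<longlonglongrightarrow> x"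
  shows "x \<in> subdifferential J x"
proof -
  have late: "\<forall>\<^sub>F n in sequentially. c < \<sigma> n" for c
    using sig by (simp add: filterlim_at_top_dense)
  obtain B where B: "\<And>n. norm (w (\<sigma> n)) \<le> B"
    using convergent_imp_Bseq[OF convergentI[OF lim]] by (auto simp: Bseq_def)
  have lower: "- B\<^sup>2 / 2 \<le> energy s" if "s0 < s" for s
  proof -
    obtain n where n: "s < \<sigma> n" using late[of s] by (auto dest: eventually_happens)
    have "0 \<le> q (\<sigma> n) \<bullet> w (\<sigma> n)"
      by (rule subgradient_inner_nonneg[OF hom subgrad]) (use n that in simp)
    moreover have "(norm (w (\<sigma> n)))\<^sup>2 \<le> B\<^sup>2" by (rule power_mono[OF B]) simp
    ultimately have "- B\<^sup>2 / 2 \<le> energy (\<sigma> n)" by (simp add: energy_def)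
    also have "\<dots> \<le> energy s" by (rule energy_antimono) (use n that in auto)
    finally show ?thesis .
  qed
  \<comment> \<open>After a time \<open>S\<close> at which the energy is within \<open>\<eta>\<^sup>2\<close> of its infimum \<open>I\<close>, it can drop by at most
      \<open>\<eta>\<^sup>2\<close>, which allows a velocity below \<open>\<eta>\<close> at some time \<open>r\<close> and a displacement of at most \<open>\<eta>\<close>.\<close>
  define I where "I = Inf (energy ` {s0<..})"
  have bdd: "bdd_below (energy ` {s0<..})" using lower by (intro bdd_belowI) auto
  have near: "\<exists>r>s0. norm (w r - x) < \<epsilon> \<and> norm (w r - q r) < \<epsilon>" if "0 < \<epsilon>" for \<epsilon>
  proof -
    define \<eta> where "\<eta> = \<epsilon> / 3"
    have eta: "0 < \<eta>" using that by (simp add: \<eta>_def)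
    have "I < I + \<eta>\<^sup>2" using eta by simp
    then obtain S where S: "s0 < S" "energy S < I + \<eta>\<^sup>2"
      using cInf_lessD[of "energy ` {s0<..}" "I + \<eta>\<^sup>2"] by (auto simp: I_def)
    have "\<forall>\<^sub>F n in sequentially. S < \<sigma> n \<and> norm (w (\<sigma> n) - x) < \<eta>"
      using late[of S] tendstoD[OF lim eta] by eventually_elim (simp add: dist_norm)
    then obtain n where n: "S < \<sigma> n" "norm (w (\<sigma> n) - x) < \<eta>"
      by (auto dest: eventually_happens)
    define a where "a = \<sigma> n"
    have a: "s0 < a" using n S by (simp add: a_def)
    have drop: "energy a - energy r < \<eta>\<^sup>2" if "a \<le> r" for r
    proof -
      have "energy a \<le> energy S" by (rule energy_antimono) (use n S in \<open>auto simp: a_def\<close>)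
      moreover have "I \<le> energy r"
        unfolding I_def using bdd a that by (intro cInf_lower) auto
      ultimately show ?thesis using S by simp
    qed
    obtain r where r: "a \<le> r" "r < a + 1" "norm (w r - q r) < \<eta>"
      using exists_small_velocity[OF a drop eta] by auto
    have "2 * \<eta> * norm (w r - w a) \<le> energy a - energy r + \<eta>\<^sup>2 * (r - a)"
      using a r(1) eta by (rule displacement_le)
    also have "\<dots> \<le> \<eta>\<^sup>2 + \<eta>\<^sup>2 * 1"
      using drop[OF r(1)] r by (intro add_mono mult_left_mono) auto
    finally have "2 * \<eta> * norm (w r - w a) \<le> 2 * \<eta> * \<eta>" by (simp add: power2_eq_square)
    then have "norm (w r - w a) \<le> \<eta>" using eta by simp
    moreover have "norm (w r - x) \<le> norm (w r - w a) + norm (w a - x)"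
      using norm_triangle_ineq[of "w r - w a" "w a - x"] by simp
    ultimately have "norm (w r - x) < \<epsilon>" using n(2) eta by (simp add: \<eta>_def a_def)
    moreover have "norm (w r - q r) < \<epsilon>" using r(3) eta by (simp add: \<eta>_def)
    moreover have "s0 < r" using a r by simp
    ultimately show ?thesis by blast
  qed
  have "\<forall>n. \<exists>r>s0. norm (w r - x) < inverse (real (Suc n)) \<and>
      norm (w r - q r) < inverse (real (Suc n))"
    by (intro allI near) simp
  then obtain \<rho> where \<rho>: "\<And>n. s0 < \<rho> n"
      "\<And>n. norm (w (\<rho> n) - x) < inverse (real (Suc n))"
      "\<And>n. norm (w (\<rho> n) - q (\<rho> n)) < inverse (real (Suc n))"
    by metis
  have "(\<lambda>n. w (\<rho> n) - x) \<longlonglongrightarrow> 0"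
    by (rule Lim_null_comparison[OF _ LIMSEQ_inverse_real_of_nat])
      (use \<rho>(2) in \<open>auto intro!: always_eventually less_imp_le\<close>)
  then have wlim: "(\<lambda>n. w (\<rho> n)) \<longlonglongrightarrow> x" by (simp add: LIM_zero_iff)
  have "(\<lambda>n. w (\<rho> n) - q (\<rho> n)) \<longlonglongrightarrow> 0"
    by (rule Lim_null_comparison[OF _ LIMSEQ_inverse_real_of_nat])
      (use \<rho>(3) in \<open>auto intro!: always_eventually less_imp_le\<close>)
  from tendsto_diff[OF wlim this] have qlim: "(\<lambda>n. q (\<rho> n)) \<longlonglongrightarrow> x" by simp
  show ?thesis
    by (rule subdifferential_closed[OF lsc _ wlim qlim]) (rule subgrad[OF \<rho>(1)])
qed

lemma gradient_flow_subgradient: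
  assumes "gradient_flow J f u p" "0 < t"
  shows "p t \<in> subdifferential J (u t)"
  using assms by (auto simp: gradient_flow_def is_arg_min_def)

text \<open>
  The factor \<open>exp s\<close> contributes the term \<open>w\<close> to the derivative. In the other term it cancels against
  the derivative \<open>exp (-s)\<close> of the time change. The initial time \<open>- ln T\<close> corresponds to \<open>t = 0\<close>.
\<close>

lemma rescaled_solution_gradient_flow:
  assumes hom: "absolutely_one_homogeneous J" and flow: "gradient_flow J f u p" and "0 < T"
  shows "rescaled_solution J (\<lambda>s. exp s *\<^sub>R u (T - exp (- s))) (\<lambda>s. p (T - exp (- s))) (- ln T)"
proof
  have pos: "0 < T - exp (- s)" if "- ln T < s" for s
  proof -
    have "exp (- s) < exp (ln T)" using that by simp
    then show ?thesis using \<open>0 < T\<close> by simp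
  qed
  have "continuous_on {0..} u" using flow by (simp add: gradient_flow_def)
  then have "continuous_on {- ln T<..} (\<lambda>s. u (T - exp (- s)))"
  proof (rule continuous_on_compose2)
    show "continuous_on {- ln T<..} (\<lambda>s. T - exp (- s))" by (intro continuous_intros)
    show "(\<lambda>s. T - exp (- s)) ` {- ln T<..} \<subseteq> {0..}" using pos less_imp_le by fastforce
  qed
  then show "continuous_on {- ln T<..} (\<lambda>s. exp s *\<^sub>R u (T - exp (- s)))"
    by (intro continuous_intros)
next
  fix s assume "- ln T < s"
  then have "exp (- s) < exp (ln T)" by simp
  then have pos: "0 < T - exp (- s)" using \<open>0 < T\<close> by simp
  have "p (T - exp (- s)) \<in> subdifferential J (u (T - exp (- s)))"
    using flow pos by (rule gradient_flow_subgradient)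
  then show "p (T - exp (- s)) \<in> subdifferential J (exp s *\<^sub>R u (T - exp (- s)))"
    by (intro subdifferential_scaleR[OF hom]) auto
  let ?\<theta> = "\<lambda>s. T - exp (- s)"
  have \<theta>: "(?\<theta> has_vector_derivative exp (- s)) (at_right s)"
    unfolding has_real_derivative_iff_has_vector_derivative[symmetric]
    by (auto intro!: derivative_eq_intros)
  have "(u has_vector_derivative - p (?\<theta> s)) (at_right (?\<theta> s))"
    using flow pos by (simp add: gradient_flow_def)
  then have "(u has_vector_derivative - p (?\<theta> s)) (at (?\<theta> s) within ?\<theta> ` {s<..})"
    by (rule has_vector_derivative_within_subset) auto
  from vector_diff_chain_within[OF \<theta> this]
  have u: "((\<lambda>s. u (?\<theta> s)) has_vector_derivative - (exp (- s) *\<^sub>R p (?\<theta> s))) (at_right s)"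
    by (simp add: o_def)
  have "(exp has_real_derivative exp s) (at_right s)"
    by (rule has_field_derivative_at_within) (rule DERIV_exp)
  from has_vector_derivative_scaleR[OF this u]
  show "((\<lambda>s. exp s *\<^sub>R u (?\<theta> s)) has_vector_derivative exp s *\<^sub>R u (?\<theta> s) - p (?\<theta> s)) (at_right s)"
    by (simp add: exp_minus)
qed

text \<open>
  Under coercivity the norm decreases at speed at least \<open>1/C\<close>: its right derivative is
  \<open>- p \<bullet> sgn u = - J(u) / \<parallel>u\<parallel>\<close>. Letting the final time tend to \<open>T\<close> and dropping the norm there
  gives the bound.
\<close>

lemma norm_ge_remaining_time:
  assumes flow: "gradient_flow J f u p"
    and nz: "\<And>t. 0 < t \<Longrightarrow> t < T \<Longrightarrow> u t \<noteq> 0"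
    and "0 < C" and coer: "\<And>t. 0 < t \<Longrightarrow> ereal (norm (u t)) \<le> ereal C * J (u t)"
    and a: "0 < a" "a < T"
  shows "(T - a) / C \<le> norm (u a)"
proof -
  have decay: "norm (u b) + b / C \<le> norm (u a) + a / C" if "a \<le> b" "b < T" for b
  proof (rule nonincreasing_if_right_derivative_le_0[of a b "\<lambda>t. norm (u t) + t / C"
        "\<lambda>t. - p t \<bullet> sgn (u t) + 1 / C"])
    have "continuous_on {a..b} u"
      by (rule continuous_on_subset[of "{0..}"]) (use flow a in \<open>auto simp: gradient_flow_def\<close>)
    then show "continuous_on {a..b} (\<lambda>t. norm (u t) + t / C)"
      using \<open>0 < C\<close> by (intro continuous_intros) auto
  next
    fix t assume "a \<le> t" "t < b"
    then have t: "0 < t" "u t \<noteq> 0" using a that nz by auto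
    have "(u has_derivative (\<lambda>h. h *\<^sub>R (- p t))) (at_right t)"
      using flow t by (simp add: gradient_flow_def has_vector_derivative_def)
    from has_derivative_compose[OF this has_derivative_norm[OF t(2)]]
    have "((\<lambda>t. norm (u t)) has_vector_derivative - p t \<bullet> sgn (u t)) (at_right t)"
      by (simp add: has_vector_derivative_def)
    moreover have "((\<lambda>t. t / C) has_vector_derivative 1 / C) (at_right t)"
      unfolding has_real_derivative_iff_has_vector_derivative[symmetric]
      by (rule DERIV_cdivide) simp
    ultimately show "((\<lambda>t. norm (u t) + t / C) has_vector_derivative
        - p t \<bullet> sgn (u t) + 1 / C) (at_right t)"
      by (rule has_vector_derivative_add)
    have "ereal (norm (u t)) \<le> ereal C * ereal (p t \<bullet> u t)"
      using coer[OF t(1)] gradient_flow_subgradient[OF flow t(1)]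
      by (simp add: subdifferential_def)
    then have "norm (u t) \<le> C * (p t \<bullet> u t)" by simp
    then have "1 / C \<le> p t \<bullet> sgn (u t)"
      using t \<open>0 < C\<close> by (simp add: sgn_div_norm field_simps)
    then show "- p t \<bullet> sgn (u t) + 1 / C \<le> 0" by simp
  qed fact
  have "T / C \<le> norm (u a) + a / C"
  proof (rule tendsto_upperbound)
    show "((\<lambda>b. b / C) \<longlongrightarrow> T / C) (at_left T)" by (intro tendsto_intros) (use \<open>0 < C\<close> in auto)
    show "\<forall>\<^sub>F b in at_left T. b / C \<le> norm (u a) + a / C"
      using eventually_at_left_real[OF a(2)]
    proof eventually_elim
      case (elim b)
      with decay[of b] norm_ge_zero[of "u b"] show ?case
        by (auto intro: order_trans[rotated])
    qed
  qed simp
  then show ?thesis by (simp add: diff_divide_distrib)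
qed

theorem theorem6p11:
  fixes J :: "'a::{real_inner, complete_space} \<Rightarrow> ereal"
    and f pstar :: 'a
    and u p :: "real \<Rightarrow> 'a"
    and T :: real
    and \<tau> :: "nat \<Rightarrow> real"
  assumes "J \<in> class_C"
    and "gradient_flow J f u p"
    and "null_projection J f = 0"
    and "extinction_time J f u = ereal T"
    and "incseq \<tau>"
    and "\<And>n. \<tau> n \<in> {0<..<T}"
    and "\<tau> \<longlonglongrightarrow> T"
    and "(\<lambda>n. rescaled_flow u T (\<tau> n)) \<longlonglongrightarrow> pstar"
  shows "pstar \<in> subdifferential J pstar \<and>
         ((\<exists>C>0. \<forall>t>0. ereal (norm (u t - null_projection J f)) \<le> ereal C * J (u t))
            \<longrightarrow> pstar \<noteq> 0)"
proof (intro conjI impI)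
  have lsc: "lower_semicontinuous J" and hom: "absolutely_one_homogeneous J"
    using \<open>J \<in> class_C\<close> by (auto simp: class_C_def)
  have \<tau>: "0 < \<tau> n" "\<tau> n < T" for n using assms(6)[of n] by auto
  have "0 < T" using \<tau>[of 0] by simp
  interpret rescaled_solution J "\<lambda>s. exp s *\<^sub>R u (T - exp (- s))" "\<lambda>s. p (T - exp (- s))" "- ln T"
    using hom assms(2) \<open>0 < T\<close> by (rule rescaled_solution_gradient_flow)
  have rescaled: "rescaled_flow u T (\<tau> n) = u (\<tau> n) /\<^sub>R (T - \<tau> n)" for n
    using \<tau> by (simp add: rescaled_flow_def)
  show "pstar \<in> subdifferential J pstar"
  proof (rule limit_point_is_eigenvector[OF lsc hom])
    have "(\<lambda>n. T - \<tau> n) \<longlonglongrightarrow> T - T" by (intro tendsto_intros assms(7))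
    then have "filterlim (\<lambda>n. T - \<tau> n) (at_right 0) sequentially"
      using \<tau> by (intro filterlim_at_withinI) auto
    from filterlim_compose[OF ln_at_0 this]
    show "filterlim (\<lambda>n. - ln (T - \<tau> n)) at_top sequentially"
      by (simp add: filterlim_uminus_at_top)
    show "(\<lambda>n. exp (- ln (T - \<tau> n)) *\<^sub>R u (T - exp (- (- ln (T - \<tau> n))))) \<longlonglongrightarrow> pstar"
      using assms(8) \<tau> by (simp add: rescaled exp_minus)
  qed
  assume "\<exists>C>0. \<forall>t>0. ereal (norm (u t - null_projection J f)) \<le> ereal C * J (u t)"
  then obtain C where "0 < C" and C: "\<And>t. 0 < t \<Longrightarrow> ereal (norm (u t)) \<le> ereal C * J (u t)"
    using assms(3) by auto
  have nz: "u t \<noteq> 0" if "0 < t" "t < T" for t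
  proof
    assume "u t = 0"
    then have "extinction_time J f u \<le> ereal t"
      unfolding extinction_time_def using that assms(3) by (intro Inf_lower) auto
    with assms(4) that show False by simp
  qed
  have "1 / C \<le> norm (rescaled_flow u T (\<tau> n))" for n
  proof -
    have "(T - \<tau> n) / C \<le> norm (u (\<tau> n))"
      using assms(2) nz \<open>0 < C\<close> C \<tau> by (rule norm_ge_remaining_time)
    then show ?thesis using \<tau>[of n] \<open>0 < C\<close> by (simp add: rescaled field_simps)
  qed
  then have "1 / C \<le> norm pstar"
    by (intro tendsto_lowerbound[OF tendsto_norm[OF assms(8)]]) auto
  then show "pstar \<noteq> 0" using \<open>0 < C\<close> by auto
qed

end
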